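(* Every free adequate semigroup and every free adequate monoid is $\mathcal{J}$-trivial, i.e. no two distinct elements generate the same principal two-sided ideal.
   Context: For a semigroup $S$ let $S^1=S$ if $S$ is a monoid and otherwise $S$ with an identity adjoined. $a\,\mathcal{L}^*\,b$ iff for all $x,y\in S^1$: $ax=ay\Leftrightarrow bx=by$; $a\,\mathcal{R}^*\,b$ iff for all $x,y\in S^1$: $xa=ya\Leftrightarrow xb=yb$. $S$ is adequate if its idempotents commute and every $\mathcal{L}^*$-class and every $\mathcal{R}^*$-class contains an idempotent (necessarily unique); $x^+$ is the idempotent $\mathcal{R}^*$-related to $x$, $x^*$ the idempotent $\mathcal{L}^*$-related to $x$. Adequate semigroups [monoids] are viewed as $(2,1,1)$-algebras [$(2,1,1,0)$-algebras], morphisms preserving all operations. The free adequate semigroup [monoid] on a set $\Sigma$ is an adequate semigroup [monoid] containing $\Sigma$ such that every map from $\Sigma$ to an adequate semigroup [monoid] extends uniquely to a morphism. Two elements $a,b$ are $\mathcal{J}$-related if $S^1aS^1=S^1bS^1$. *)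

theory Defs
  imports Main
begin

text \<open>A (2,1,1)-algebra is given by a carrier set S, a binary operation m and two
unary operations p (the plus operation) and s (the star operation).\<close>

definition semigroup_on :: "'a set \<Rightarrow> ('a \<Rightarrow> 'a \<Rightarrow> 'a) \<Rightarrow> bool" where
  "semigroup_on S m \<longleftrightarrow>
     (\<forall>x\<in>S. \<forall>y\<in>S. m x y \<in> S) \<and>
     (\<forall>x\<in>S. \<forall>y\<in>S. \<forall>z\<in>S. m (m x y) z = m x (m y z))"

definition idem :: "('a \<Rightarrow> 'a \<Rightarrow> 'a) \<Rightarrow> 'a \<Rightarrow> bool" where
  "idem m e \<longleftrightarrow> m e e = e"

text \<open>L* and R*, with x, y ranging over S^1. Adjoining an identity 1 only adds the
cases where x or y is 1 (a*1 = a), which are written out explicitly; when S is already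
a monoid these extra clauses are implied by the others, so this is exactly the
definition via S^1 in both cases.\<close>

definition Lstar :: "'a set \<Rightarrow> ('a \<Rightarrow> 'a \<Rightarrow> 'a) \<Rightarrow> 'a \<Rightarrow> 'a \<Rightarrow> bool" where
  "Lstar S m a b \<longleftrightarrow>
     (\<forall>x\<in>S. \<forall>y\<in>S. m a x = m a y \<longleftrightarrow> m b x = m b y) \<and>
     (\<forall>x\<in>S. m a x = a \<longleftrightarrow> m b x = b)"

definition Rstar :: "'a set \<Rightarrow> ('a \<Rightarrow> 'a \<Rightarrow> 'a) \<Rightarrow> 'a \<Rightarrow> 'a \<Rightarrow> bool" where
  "Rstar S m a b \<longleftrightarrow>
     (\<forall>x\<in>S. \<forall>y\<in>S. m x a = m y a \<longleftrightarrow> m x b = m y b) \<and>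
     (\<forall>x\<in>S. m x a = a \<longleftrightarrow> m x b = b)"

text \<open>Adequate semigroup viewed as a (2,1,1)-algebra: idempotents commute, p x is the
(unique) idempotent R*-related to x and s x the (unique) idempotent L*-related to x.\<close>

definition adequate_semigroup ::
  "'a set \<Rightarrow> ('a \<Rightarrow> 'a \<Rightarrow> 'a) \<Rightarrow> ('a \<Rightarrow> 'a) \<Rightarrow> ('a \<Rightarrow> 'a) \<Rightarrow> bool" where
  "adequate_semigroup S m p s \<longleftrightarrow>
     semigroup_on S m \<and>
     (\<forall>e\<in>S. \<forall>f\<in>S. idem m e \<and> idem m f \<longrightarrow> m e f = m f e) \<and>
     (\<forall>x\<in>S. p x \<in> S \<and> idem m (p x) \<and> Rstar S m (p x) x) \<and>
     (\<forall>x\<in>S. s x \<in> S \<and> idem m (s x) \<and> Lstar S m (s x) x)"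

definition monoid_identity :: "'a set \<Rightarrow> ('a \<Rightarrow> 'a \<Rightarrow> 'a) \<Rightarrow> 'a \<Rightarrow> bool" where
  "monoid_identity S m e \<longleftrightarrow> e \<in> S \<and> (\<forall>x\<in>S. m e x = x \<and> m x e = x)"

definition adequate_monoid ::
  "'a set \<Rightarrow> ('a \<Rightarrow> 'a \<Rightarrow> 'a) \<Rightarrow> ('a \<Rightarrow> 'a) \<Rightarrow> ('a \<Rightarrow> 'a) \<Rightarrow> 'a \<Rightarrow> bool" where
  "adequate_monoid S m p s e \<longleftrightarrow> adequate_semigroup S m p s \<and> monoid_identity S m e"

definition adequate_hom ::
  "('a \<Rightarrow> 'b) \<Rightarrow> 'a set \<Rightarrow> ('a \<Rightarrow> 'a \<Rightarrow> 'a) \<Rightarrow> ('a \<Rightarrow> 'a) \<Rightarrow> ('a \<Rightarrow> 'a)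
     \<Rightarrow> 'b set \<Rightarrow> ('b \<Rightarrow> 'b \<Rightarrow> 'b) \<Rightarrow> ('b \<Rightarrow> 'b) \<Rightarrow> ('b \<Rightarrow> 'b) \<Rightarrow> bool" where
  "adequate_hom h S m p s T mT pT sT \<longleftrightarrow>
     (\<forall>x\<in>S. h x \<in> T) \<and>
     (\<forall>x\<in>S. \<forall>y\<in>S. h (m x y) = mT (h x) (h y)) \<and>
     (\<forall>x\<in>S. h (p x) = pT (h x)) \<and>
     (\<forall>x\<in>S. h (s x) = sT (h x))"

definition free_adequate_semigroup_wrt ::
  "'b itself \<Rightarrow> 'a set \<Rightarrow> ('a \<Rightarrow> 'a \<Rightarrow> 'a) \<Rightarrow> ('a \<Rightarrow> 'a) \<Rightarrow> ('a \<Rightarrow> 'a) \<Rightarrow> 'a set \<Rightarrow> bool" where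
  "free_adequate_semigroup_wrt (_::'b itself) S m p s \<Sigma> \<longleftrightarrow>
     adequate_semigroup S m p s \<and> \<Sigma> \<subseteq> S \<and>
     (\<forall>(T::'b set) mT pT sT f.
        adequate_semigroup T mT pT sT \<and> f ` \<Sigma> \<subseteq> T \<longrightarrow>
        (\<exists>h. adequate_hom h S m p s T mT pT sT \<and> (\<forall>a\<in>\<Sigma>. h a = f a) \<and>
             (\<forall>h'. adequate_hom h' S m p s T mT pT sT \<and> (\<forall>a\<in>\<Sigma>. h' a = f a)
                   \<longrightarrow> (\<forall>x\<in>S. h' x = h x))))"

definition free_adequate_monoid_wrt ::
  "'b itself \<Rightarrow> 'a set \<Rightarrow> ('a \<Rightarrow> 'a \<Rightarrow> 'a) \<Rightarrow> ('a \<Rightarrow> 'a) \<Rightarrow> ('a \<Rightarrow> 'a) \<Rightarrow> 'a \<Rightarrow> 'a set \<Rightarrow> bool" where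
  "free_adequate_monoid_wrt (_::'b itself) S m p s e \<Sigma> \<longleftrightarrow>
     adequate_monoid S m p s e \<and> \<Sigma> \<subseteq> S \<and>
     (\<forall>(T::'b set) mT pT sT eT f.
        adequate_monoid T mT pT sT eT \<and> f ` \<Sigma> \<subseteq> T \<longrightarrow>
        (\<exists>h. adequate_hom h S m p s T mT pT sT \<and> h e = eT \<and> (\<forall>a\<in>\<Sigma>. h a = f a) \<and>
             (\<forall>h'. adequate_hom h' S m p s T mT pT sT \<and> h' e = eT \<and>
                   (\<forall>a\<in>\<Sigma>. h' a = f a) \<longrightarrow> (\<forall>x\<in>S. h' x = h x))))"

definition free_adequate_semigroup ::
  "'a set \<Rightarrow> ('a \<Rightarrow> 'a \<Rightarrow> 'a) \<Rightarrow> ('a \<Rightarrow> 'a) \<Rightarrow> ('a \<Rightarrow> 'a) \<Rightarrow> 'a set \<Rightarrow> bool" where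
  "free_adequate_semigroup S m p s \<Sigma> \<longleftrightarrow>
     free_adequate_semigroup_wrt TYPE(nat \<times> 'a) S m p s \<Sigma>"

definition free_adequate_monoid ::
  "'a set \<Rightarrow> ('a \<Rightarrow> 'a \<Rightarrow> 'a) \<Rightarrow> ('a \<Rightarrow> 'a) \<Rightarrow> ('a \<Rightarrow> 'a) \<Rightarrow> 'a \<Rightarrow> 'a set \<Rightarrow> bool" where
  "free_adequate_monoid S m p s e \<Sigma> \<longleftrightarrow>
     free_adequate_monoid_wrt TYPE(nat \<times> 'a) S m p s e \<Sigma>"

text \<open>Principal two-sided ideal S^1 a S^1 (the identity of S^1 written out).\<close>

definition principal_ideal :: "'a set \<Rightarrow> ('a \<Rightarrow> 'a \<Rightarrow> 'a) \<Rightarrow> 'a \<Rightarrow> 'a set" where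
  "principal_ideal S m a =
     {a} \<union> {m x a | x. x \<in> S} \<union> {m a y | y. y \<in> S} \<union> {m (m x a) y | x y. x \<in> S \<and> y \<in> S}"

definition J_trivial :: "'a set \<Rightarrow> ('a \<Rightarrow> 'a \<Rightarrow> 'a) \<Rightarrow> bool" where
  "J_trivial S m \<longleftrightarrow>
     (\<forall>a\<in>S. \<forall>b\<in>S. principal_ideal S m a = principal_ideal S m b \<longrightarrow> a = b)"

end

theory Submission
  imports Defs
begin

text \<open>The additive monoid of natural numbers is adequate, with both unary operations constantly
0, so sending every generator to 1 yields a length homomorphism. The elements that have positive
length or are idempotent form a subalgebra containing the generators; since a free object is
generated by its generators, every element of length 0 is idempotent. If a and b generate the same
ideal, they have the same length, so a = x b y and b = u a v where x, y, u, v have length 0 and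
hence are commuting idempotents. Then u a = u x b y = x u b y = x b y = a because u b = b, dually
a v = a, and so b = u a v = a.\<close>

section \<open>Elementary algebra of adequate semigroups\<close>

lemma adequate_closed:
  assumes "adequate_semigroup S m p s"
  shows "\<And>x y. x \<in> S \<Longrightarrow> y \<in> S \<Longrightarrow> m x y \<in> S"
    and "\<And>x. x \<in> S \<Longrightarrow> p x \<in> S" and "\<And>x. x \<in> S \<Longrightarrow> s x \<in> S"
  using assms by (auto simp: adequate_semigroup_def semigroup_on_def)

lemma adequate_assoc:
  assumes "adequate_semigroup S m p s" "x \<in> S" "y \<in> S" "z \<in> S"
  shows "m (m x y) z = m x (m y z)"
  using assms by (auto simp: adequate_semigroup_def semigroup_on_def)

lemma adequate_idem_commute:
  assumes "adequate_semigroup S m p s" "e \<in> S" "f \<in> S" "idem m e" "idem m f"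
  shows "m e f = m f e"
  using assms by (auto simp: adequate_semigroup_def)

lemma adequate_idem_plus_star:
  assumes "adequate_semigroup S m p s" "x \<in> S"
  shows "idem m (p x)" "idem m (s x)"
  using assms by (auto simp: adequate_semigroup_def)

text \<open>The idempotent \<open>p x\<close> is fixed by left multiplication by itself. The clause
  of \<open>Rstar\<close> in which one multiplier is the adjoined identity transfers this from
  \<open>p x\<close> to \<open>x\<close>.\<close>

lemma adequate_plus_mult:
  assumes "adequate_semigroup S m p s" "x \<in> S"
  shows "m (p x) x = x"
proof -
  have "p x \<in> S" "m (p x) (p x) = p x" "Rstar S m (p x) x"
    using assms by (auto simp: adequate_semigroup_def idem_def)
  then show ?thesis by (auto simp: Rstar_def)
qed

lemma adequate_mult_star:
  assumes "adequate_semigroup S m p s" "x \<in> S"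
  shows "m x (s x) = x"
proof -
  have "s x \<in> S" "m (s x) (s x) = s x" "Lstar S m (s x) x"
    using assms by (auto simp: adequate_semigroup_def idem_def)
  then show ?thesis by (auto simp: Lstar_def)
qed

lemma adequate_idem_mult:
  assumes "adequate_semigroup S m p s" and e: "e \<in> S" "idem m e" and f: "f \<in> S" "idem m f"
  shows "idem m (m e f)"
proof -
  note [simp] = adequate_closed[OF assms(1)] adequate_assoc[OF assms(1)]
  have "m (m e f) (m e f) = m e (m (m f e) f)" using e f by simp
  also have "\<dots> = m e (m (m e f) f)"
    using adequate_idem_commute[OF assms(1) e(1) f(1) e(2) f(2)] by simp
  also have "\<dots> = m (m e e) (m f f)" using e f by simp
  also have "\<dots> = m e f" using e f by (simp add: idem_def)
  finally show ?thesis by (simp add: idem_def)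
qed

lemma idem_absorb_left:
  assumes "adequate_semigroup S m p s" "e \<in> S" "idem m e" "c \<in> S" "b = m e c"
  shows "m e b = b"
  using assms adequate_assoc[of S m p s e e c] by (simp add: idem_def)

lemma idem_absorb_right:
  assumes "adequate_semigroup S m p s" "e \<in> S" "idem m e" "c \<in> S" "b = m c e"
  shows "m b e = b"
  using assms adequate_assoc[of S m p s c e e] by (simp add: idem_def)

lemma eq_if_idem_multiples:
  assumes A: "adequate_semigroup S m p s" and "a \<in> S" "b \<in> S"
    and x: "x \<in> S" "idem m x" and y: "y \<in> S" "idem m y" and a: "a = m (m x b) y"
    and u: "u \<in> S" "idem m u" and v: "v \<in> S" "idem m v" and b: "b = m (m u a) v"
  shows "a = b"
proof -
  note cl = adequate_closed[OF A] and as = adequate_assoc[OF A]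
  have "m u b = b"
    by (rule idem_absorb_left[OF A u, of "m a v"]) (use b cl as assms(2) u v in auto)
  have "m b v = b"
    by (rule idem_absorb_right[OF A v, of "m u a"]) (use b cl as assms(2) u v in auto)
  \<comment> \<open>Commuting \<open>u\<close> past \<open>x\<close> brings it next to
    \<open>b\<close>, which absorbs it; the computation for \<open>v\<close> is the mirror
    image.\<close>
  have "m u a = m (m (m u x) b) y" using a cl as x y u \<open>b \<in> S\<close> by simp
  also have "\<dots> = m (m (m x u) b) y"
    using adequate_idem_commute[OF A u(1) x(1) u(2) x(2)] by simp
  also have "\<dots> = m (m x (m u b)) y" using cl as x y u \<open>b \<in> S\<close> by simp
  finally have ua: "m u a = a" using \<open>m u b = b\<close> a by simp
  have "m a v = m (m x b) (m y v)" using a cl as x y v \<open>b \<in> S\<close> by simp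
  also have "\<dots> = m (m x b) (m v y)"
    using adequate_idem_commute[OF A y(1) v(1) y(2) v(2)] by simp
  also have "\<dots> = m (m x (m b v)) y" using cl as x y v \<open>b \<in> S\<close> by simp
  finally have "m a v = a" using \<open>m b v = b\<close> a by simp
  with ua b show ?thesis by simp
qed

text \<open>This isolates what freeness has to supply, so that the semigroup and the monoid case
  share the whole ideal-theoretic argument.\<close>

lemma J_trivial_if_length:
  fixes len :: "'a \<Rightarrow> nat"
  assumes A: "adequate_semigroup S m p s"
    and len: "\<And>x y. x \<in> S \<Longrightarrow> y \<in> S \<Longrightarrow> len (m x y) = len x + len y"
    and idem: "\<And>x. x \<in> S \<Longrightarrow> len x = 0 \<Longrightarrow> idem m x"
  shows "J_trivial S m"
proof -
  note cl = adequate_closed[OF A]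
  \<comment> \<open>Multiplication adds lengths, so no element of an ideal is shorter than its
    generator; equal ideals thus have generators of equal length.\<close>
  have le: "len b \<le> len a" if "b \<in> S" "a \<in> principal_ideal S m b" for a b
    using that by (auto simp: principal_ideal_def len cl)
  \<comment> \<open>By additivity and cancellation, any multipliers present have length 0 and so are
    idempotent. A missing one is replaced by \<open>p b\<close> on the left or \<open>s b\<close> on
    the right, which fix \<open>b\<close>; the four shapes of ideal members reduce to one.\<close>
  have dec: "\<exists>x\<in>S. \<exists>y\<in>S. idem m x \<and> idem m y \<and> a = m (m x b) y"
    if b: "b \<in> S" and a: "a \<in> principal_ideal S m b" and eq: "len a = len b" for a b
  proof -
    note plus = cl(2)[OF b] adequate_idem_plus_star(1)[OF A b] adequate_plus_mult[OF A b]
    note star = cl(3)[OF b] adequate_idem_plus_star(2)[OF A b] adequate_mult_star[OF A b]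
    from a consider "a = b"
      | x where "x \<in> S" "a = m x b"
      | y where "y \<in> S" "a = m b y"
      | x y where "x \<in> S" "y \<in> S" "a = m (m x b) y"
      by (auto simp: principal_ideal_def)
    then show ?thesis
    proof cases
      case 1
      then have "a = m (m (p b) b) (s b)" using plus star by simp
      then show ?thesis using plus star by blast
    next
      case (2 x)
      then have "idem m x" using eq b by (intro idem) (auto simp: len)
      moreover have "a = m (m x b) (s b)"
        using 2 b star adequate_assoc[OF A, of x b "s b"] by simp
      ultimately show ?thesis using 2 star by blast
    next
      case (3 y)
      then have "idem m y" using eq b by (intro idem) (auto simp: len)
      moreover have "a = m (m (p b) b) y" using 3 plus by simp
      ultimately show ?thesis using 3 plus by blast
    next
      case (4 x y)
      then have "idem m x" "idem m y" using eq b by (auto intro!: idem simp: len cl)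
      then show ?thesis using 4 by blast
    qed
  qed
  show ?thesis unfolding J_trivial_def
  proof (intro ballI impI)
    fix a b assume ab: "a \<in> S" "b \<in> S" and eq: "principal_ideal S m a = principal_ideal S m b"
    then have mem: "a \<in> principal_ideal S m b" "b \<in> principal_ideal S m a"
      by (auto simp: principal_ideal_def)
    then have leneq: "len a = len b" using le ab by (simp add: le_antisym)
    from dec[OF ab(2) mem(1) leneq] obtain x y
      where "x \<in> S" "y \<in> S" "idem m x" "idem m y" "a = m (m x b) y" by blast
    moreover from dec[OF ab(1) mem(2) leneq[symmetric]] obtain u v
      where "u \<in> S" "v \<in> S" "idem m u" "idem m v" "b = m (m u a) v" by blast
    ultimately show "a = b" using eq_if_idem_multiples[OF A ab] by metis
  qed
qed

section \<open>Subalgebras and generation of free objects\<close>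

definition subalgebra_on ::
  "'a set \<Rightarrow> 'a set \<Rightarrow> ('a \<Rightarrow> 'a \<Rightarrow> 'a) \<Rightarrow> ('a \<Rightarrow> 'a) \<Rightarrow> ('a \<Rightarrow> 'a) \<Rightarrow> bool" where
  "subalgebra_on G S m p s \<longleftrightarrow> G \<subseteq> S \<and> (\<forall>x\<in>G. \<forall>y\<in>G. m x y \<in> G) \<and>
     (\<forall>x\<in>G. p x \<in> G) \<and> (\<forall>x\<in>G. s x \<in> G)"

lemma subalgebra_on_self:
  "adequate_semigroup S m p s \<Longrightarrow> subalgebra_on S S m p s"
  by (auto simp: subalgebra_on_def adequate_closed)

text \<open>A product with a factor of positive length has positive length, a product of two
  idempotents is idempotent because they commute, and all values of \<open>p\<close> and
  \<open>s\<close> are idempotent.\<close>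

lemma subalgebra_positive_or_idem:
  fixes len :: "'a \<Rightarrow> nat"
  assumes A: "adequate_semigroup S m p s"
    and len: "\<And>x y. x \<in> S \<Longrightarrow> y \<in> S \<Longrightarrow> len (m x y) = len x + len y"
  shows "subalgebra_on {x \<in> S. 0 < len x \<or> idem m x} S m p s"
  using adequate_closed[OF A] adequate_idem_mult[OF A] adequate_idem_plus_star[OF A] len
  by (auto simp: subalgebra_on_def)

text \<open>The universal properties in the definitions only quantify over algebras with carrier in
\<^typ>\<open>nat \<times> 'a\<close>; \<open>Pair 0\<close> copies algebras on \<^typ>\<open>'a\<close> into this type.\<close>

abbreviation (input) copy_mult :: "('a \<Rightarrow> 'a \<Rightarrow> 'a) \<Rightarrow> nat \<times> 'a \<Rightarrow> nat \<times> 'a \<Rightarrow> nat \<times> 'a" where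
  "copy_mult m \<equiv> \<lambda>u v. (0, m (snd u) (snd v))"

abbreviation (input) copy_unary :: "('a \<Rightarrow> 'a) \<Rightarrow> nat \<times> 'a \<Rightarrow> nat \<times> 'a" where
  "copy_unary p \<equiv> \<lambda>u. (0, p (snd u))"

text \<open>The conditions in \<open>Rstar\<close> and \<open>Lstar\<close> are universal over
  multipliers, so they survive the passage from \<open>S\<close> to the smaller \<open>G\<close>,
  which still contains the idempotents \<open>p x\<close> and \<open>s x\<close>.\<close>

lemma adequate_semigroup_copy:
  assumes A: "adequate_semigroup S m p s" and G: "subalgebra_on G S m p s"
  shows "adequate_semigroup (Pair 0 ` G) (copy_mult m) (copy_unary p) (copy_unary s)"
proof -
  have sub: "\<And>x. x \<in> G \<Longrightarrow> x \<in> S" and cl: "\<And>x y. x \<in> G \<Longrightarrow> y \<in> G \<Longrightarrow> m x y \<in> G"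
    "\<And>x. x \<in> G \<Longrightarrow> p x \<in> G" "\<And>x. x \<in> G \<Longrightarrow> s x \<in> G"
    using G by (auto simp: subalgebra_on_def)
  have R: "Rstar S m (p x) x" and L: "Lstar S m (s x) x" if "x \<in> G" for x
    using A that sub by (auto simp: adequate_semigroup_def)
  have "Rstar (Pair 0 ` G) (copy_mult m) (0, p x) (0, x)" if "x \<in> G" for x
    using R[OF that] sub by (simp add: Rstar_def)
  moreover have "Lstar (Pair 0 ` G) (copy_mult m) (0, s x) (0, x)" if "x \<in> G" for x
    using L[OF that] sub by (simp add: Lstar_def)
  ultimately show ?thesis
    using adequate_assoc[OF A] adequate_idem_commute[OF A] adequate_idem_plus_star[OF A] cl sub
    by (auto simp: adequate_semigroup_def semigroup_on_def idem_def)
qed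

lemma adequate_hom_copy:
  "adequate_semigroup S m p s \<Longrightarrow>
   adequate_hom (Pair 0) S m p s (Pair 0 ` S) (copy_mult m) (copy_unary p) (copy_unary s)"
  by (auto simp: adequate_hom_def)

lemma adequate_hom_mono:
  "adequate_hom h S m p s T mT pT sT \<Longrightarrow> T \<subseteq> T' \<Longrightarrow> adequate_hom h S m p s T' mT pT sT"
  by (auto simp: adequate_hom_def)

lemma free_semigroup_extend:
  fixes S :: "'a set" and T :: "(nat \<times> 'a) set"
  assumes "free_adequate_semigroup S m p s \<Sigma>" "adequate_semigroup T mT pT sT" "f ` \<Sigma> \<subseteq> T"
  obtains h where "adequate_hom h S m p s T mT pT sT" "\<And>a. a \<in> \<Sigma> \<Longrightarrow> h a = f a"
    "\<And>h' x. adequate_hom h' S m p s T mT pT sT \<Longrightarrow> (\<And>a. a \<in> \<Sigma> \<Longrightarrow> h' a = f a) \<Longrightarrow>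
       x \<in> S \<Longrightarrow> h' x = h x"
proof -
  have "\<exists>h. adequate_hom h S m p s T mT pT sT \<and> (\<forall>a\<in>\<Sigma>. h a = f a) \<and>
      (\<forall>h'. adequate_hom h' S m p s T mT pT sT \<and> (\<forall>a\<in>\<Sigma>. h' a = f a) \<longrightarrow> (\<forall>x\<in>S. h' x = h x))"
    using assms(1)[unfolded free_adequate_semigroup_def free_adequate_semigroup_wrt_def,
        THEN conjunct2, THEN conjunct2, rule_format, OF conjI, OF assms(2,3)] .
  then show thesis using that by blast
qed

lemma free_monoid_extend:
  fixes S :: "'a set" and T :: "(nat \<times> 'a) set"
  assumes "free_adequate_monoid S m p s e \<Sigma>" "adequate_monoid T mT pT sT eT" "f ` \<Sigma> \<subseteq> T"
  obtains h where "adequate_hom h S m p s T mT pT sT" "h e = eT" "\<And>a. a \<in> \<Sigma> \<Longrightarrow> h a = f a"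
    "\<And>h' x. adequate_hom h' S m p s T mT pT sT \<Longrightarrow> h' e = eT \<Longrightarrow>
       (\<And>a. a \<in> \<Sigma> \<Longrightarrow> h' a = f a) \<Longrightarrow> x \<in> S \<Longrightarrow> h' x = h x"
proof -
  have "\<exists>h. adequate_hom h S m p s T mT pT sT \<and> h e = eT \<and> (\<forall>a\<in>\<Sigma>. h a = f a) \<and>
      (\<forall>h'. adequate_hom h' S m p s T mT pT sT \<and> h' e = eT \<and> (\<forall>a\<in>\<Sigma>. h' a = f a) \<longrightarrow>
        (\<forall>x\<in>S. h' x = h x))"
    using assms(1)[unfolded free_adequate_monoid_def free_adequate_monoid_wrt_def,
        THEN conjunct2, THEN conjunct2, rule_format, OF conjI, OF assms(2,3)] .
  then show thesis using that by blast
qed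

text \<open>The inclusion of the generators into \<open>G\<close> extends to a morphism from
  \<open>S\<close> to \<open>G\<close>. Followed by the inclusion of \<open>G\<close> in
  \<open>S\<close>, it agrees with the identity on generators, so by uniqueness it is the identity,
  and its image lies in \<open>G\<close>.\<close>

lemma free_semigroup_generated:
  assumes F: "free_adequate_semigroup S m p s \<Sigma>"
    and G: "subalgebra_on G S m p s" and "\<Sigma> \<subseteq> G"
  shows "S \<subseteq> G"
proof -
  let ?m = "copy_mult m" and ?p = "copy_unary p" and ?s = "copy_unary s"
  have A: "adequate_semigroup S m p s"
    using F by (auto simp: free_adequate_semigroup_def free_adequate_semigroup_wrt_def)
  have "G \<subseteq> S" using G by (simp add: subalgebra_on_def)
  obtain h where h: "adequate_hom h S m p s (Pair 0 ` G) ?m ?p ?s"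
      "\<And>a. a \<in> \<Sigma> \<Longrightarrow> h a = (0, a)"
    by (rule free_semigroup_extend[OF F adequate_semigroup_copy[OF A G], where f = "Pair 0"])
      (use \<open>\<Sigma> \<subseteq> G\<close> in auto)
  \<comment> \<open>\<open>k\<close> is the common value through which uniqueness compares
    \<open>h\<close> with \<open>Pair 0\<close>, both morphisms into the copy of all of
    \<open>S\<close>.\<close>
  obtain k where k: "\<And>h' x. adequate_hom h' S m p s (Pair 0 ` S) ?m ?p ?s \<Longrightarrow>
      (\<And>a. a \<in> \<Sigma> \<Longrightarrow> h' a = (0, a)) \<Longrightarrow> x \<in> S \<Longrightarrow> h' x = k x"
    by (rule free_semigroup_extend[OF F adequate_semigroup_copy[OF A subalgebra_on_self[OF A]],
          where f = "Pair 0"]) (use \<open>\<Sigma> \<subseteq> G\<close> \<open>G \<subseteq> S\<close> in auto)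
  have hS: "adequate_hom h S m p s (Pair 0 ` S) ?m ?p ?s"
    using h(1) \<open>G \<subseteq> S\<close> by (blast intro: adequate_hom_mono)
  show ?thesis
  proof
    fix x assume x: "x \<in> S"
    have "h x = (0, x)"
      using k[OF hS h(2) x] k[OF adequate_hom_copy[OF A] refl x] by simp
    moreover have "h x \<in> Pair 0 ` G" using h(1) x by (simp add: adequate_hom_def)
    ultimately show "x \<in> G" by auto
  qed
qed

text \<open>The semigroup argument carries over once \<open>G\<close> contains \<open>e\<close>,
  since the copy of \<open>G\<close> must be a monoid with the copied identity for the extension to
  exist.\<close>

lemma free_monoid_generated:
  assumes F: "free_adequate_monoid S m p s e \<Sigma>"
    and G: "subalgebra_on G S m p s" and "e \<in> G" "\<Sigma> \<subseteq> G"
  shows "S \<subseteq> G"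
proof -
  let ?m = "copy_mult m" and ?p = "copy_unary p" and ?s = "copy_unary s"
  have A: "adequate_semigroup S m p s" and e: "monoid_identity S m e"
    using F by (auto simp: free_adequate_monoid_def free_adequate_monoid_wrt_def
        adequate_monoid_def)
  have "G \<subseteq> S" using G by (simp add: subalgebra_on_def)
  \<comment> \<open>Stated for an arbitrary \<open>H\<close> because both \<open>G\<close> and
    \<open>S\<close> serve as targets.\<close>
  have M: "adequate_monoid (Pair 0 ` H) ?m ?p ?s (0, e)"
    if "subalgebra_on H S m p s" "e \<in> H" for H
    using adequate_semigroup_copy[OF A that(1)] that e
    by (auto simp: adequate_monoid_def monoid_identity_def subalgebra_on_def)
  obtain h where h: "adequate_hom h S m p s (Pair 0 ` G) ?m ?p ?s" "h e = (0, e)"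
      "\<And>a. a \<in> \<Sigma> \<Longrightarrow> h a = (0, a)"
    by (rule free_monoid_extend[OF F M[OF G \<open>e \<in> G\<close>], where f = "Pair 0"])
      (use \<open>\<Sigma> \<subseteq> G\<close> in auto)
  obtain k where k: "\<And>h' x. adequate_hom h' S m p s (Pair 0 ` S) ?m ?p ?s \<Longrightarrow> h' e = (0, e) \<Longrightarrow>
      (\<And>a. a \<in> \<Sigma> \<Longrightarrow> h' a = (0, a)) \<Longrightarrow> x \<in> S \<Longrightarrow> h' x = k x"
    by (rule free_monoid_extend[OF F M[OF subalgebra_on_self[OF A]], where f = "Pair 0"])
      (use \<open>\<Sigma> \<subseteq> G\<close> \<open>G \<subseteq> S\<close> \<open>e \<in> G\<close> in auto)
  have hS: "adequate_hom h S m p s (Pair 0 ` S) ?m ?p ?s"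
    using h(1) \<open>G \<subseteq> S\<close> by (blast intro: adequate_hom_mono)
  show ?thesis
  proof
    fix x assume x: "x \<in> S"
    have "h x = (0, x)"
      using k[OF hS h(2,3) x] k[OF adequate_hom_copy[OF A] refl refl x] by simp
    moreover have "h x \<in> Pair 0 ` G" using h(1) x by (simp add: adequate_hom_def)
    ultimately show "x \<in> G" by auto
  qed
qed

section \<open>The length homomorphism and the two conclusions\<close>

text \<open>Addition is cancellative, so every number is related to 0 under both
  \<open>Rstar\<close> and \<open>Lstar\<close>. The constant \<open>c\<close> is padding that
  places the naturals in the type over which freeness quantifies.\<close>

lemma adequate_monoid_nat:
  "adequate_monoid (range (\<lambda>n::nat. (n, c))) (\<lambda>u v. (fst u + fst v, c))
     (\<lambda>_. (0, c)) (\<lambda>_. (0, c)) (0, c)"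
  by (auto simp: adequate_monoid_def adequate_semigroup_def semigroup_on_def monoid_identity_def
      idem_def Rstar_def Lstar_def)

lemma J_trivial_free_semigroup:
  assumes F: "free_adequate_semigroup S m p s \<Sigma>"
  shows "J_trivial S m"
proof -
  have A: "adequate_semigroup S m p s" and "\<Sigma> \<subseteq> S"
    using F by (auto simp: free_adequate_semigroup_def free_adequate_semigroup_wrt_def)
  fix c :: 'a
  have N: "adequate_semigroup (range (\<lambda>n::nat. (n, c))) (\<lambda>u v. (fst u + fst v, c))
     (\<lambda>_. (0, c)) (\<lambda>_. (0, c))"
    using adequate_monoid_nat[of c] by (simp add: adequate_monoid_def)
  obtain h where h: "adequate_hom h S m p s (range (\<lambda>n::nat. (n, c)))
      (\<lambda>u v. (fst u + fst v, c)) (\<lambda>_. (0, c)) (\<lambda>_. (0, c))" "\<And>a. a \<in> \<Sigma> \<Longrightarrow> h a = (1, c)"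
    by (rule free_semigroup_extend[OF F N, where f = "\<lambda>_. (1, c)"]) auto
  define len where "len x = fst (h x)" for x
  have len: "len (m x y) = len x + len y" if "x \<in> S" "y \<in> S" for x y
    using h(1) that by (simp add: adequate_hom_def len_def)
  \<comment> \<open>Generators have length 1, so they lie in this subalgebra, and generation makes
    it all of \<open>S\<close>.\<close>
  have "S \<subseteq> {x \<in> S. 0 < len x \<or> idem m x}"
    by (rule free_semigroup_generated[OF F subalgebra_positive_or_idem[OF A, where len = len]])
      (use \<open>\<Sigma> \<subseteq> S\<close> h(2) len in \<open>auto simp: len_def\<close>)
  then show ?thesis using len by (intro J_trivial_if_length[OF A, where len = len]) auto
qed

lemma J_trivial_free_monoid:
  assumes F: "free_adequate_monoid S m p s e \<Sigma>"
  shows "J_trivial S m"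
proof -
  have A: "adequate_semigroup S m p s" and e: "e \<in> S" "idem m e" and "\<Sigma> \<subseteq> S"
    using F by (auto simp: free_adequate_monoid_def free_adequate_monoid_wrt_def
        adequate_monoid_def monoid_identity_def idem_def)
  fix c :: 'a
  obtain h where h: "adequate_hom h S m p s (range (\<lambda>n::nat. (n, c)))
      (\<lambda>u v. (fst u + fst v, c)) (\<lambda>_. (0, c)) (\<lambda>_. (0, c))" "\<And>a. a \<in> \<Sigma> \<Longrightarrow> h a = (1, c)"
    by (rule free_monoid_extend[OF F adequate_monoid_nat, where f = "\<lambda>_. (1, c)"]) auto
  define len where "len x = fst (h x)" for x
  have len: "len (m x y) = len x + len y" if "x \<in> S" "y \<in> S" for x y
    using h(1) that by (simp add: adequate_hom_def len_def)
  \<comment> \<open>Besides the generators, the identity must belong to the subalgebra; it does so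
    as an idempotent.\<close>
  have "S \<subseteq> {x \<in> S. 0 < len x \<or> idem m x}"
    by (rule free_monoid_generated[OF F subalgebra_positive_or_idem[OF A, where len = len]])
      (use \<open>\<Sigma> \<subseteq> S\<close> h(2) e len in \<open>auto simp: len_def\<close>)
  then show ?thesis using len by (intro J_trivial_if_length[OF A, where len = len]) auto
qed

theorem theorem7p2:
  shows "(\<forall>(S::'a set) m p s \<Sigma>. free_adequate_semigroup S m p s \<Sigma> \<longrightarrow> J_trivial S m) \<and>
         (\<forall>(S::'a set) m p s e \<Sigma>. free_adequate_monoid S m p s e \<Sigma> \<longrightarrow> J_trivial S m)"
  by (intro conjI allI impI) (erule J_trivial_free_semigroup J_trivial_free_monoid)+

end
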